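(* (1) $\mathsf{S}_1(\Omega,\Gamma)=\binom{\mathrm{T}}{\Gamma}\cap\mathsf{S}_{fin}(\Omega,\mathrm{T})$. (2) $\mathsf{S}_1(\mathcal{B}_\Omega,\mathcal{B}_\Gamma)=\binom{\mathcal{B}_\mathrm{T}}{\mathcal{B}_\Gamma}\cap\mathsf{S}_{fin}(\mathcal{B}_\Omega,\mathcal{B}_\mathrm{T})$. (Equalities of classes of sets of reals.)
   Context: All spaces $X$ are infinite sets of reals, and all covers considered are assumed not to contain $X$ as a member. A cover is an $\omega$-cover of $X$ if every finite subset of $X$ is contained in some member; a $\gamma$-cover if it is infinite and each point of $X$ lies in all but finitely many members; large if each point lies in infinitely many members. A large cover $\mathcal{U}$ of $X$ is a $\tau$-cover if for all $x,y\in X$, either ($x\in U\Rightarrow y\in U$) for all but finitely many $U\in\mathcal{U}$, or ($y\in U\Rightarrow x\in U$) for all but finitely many $U\in\mathcal{U}$. $\Omega,\Gamma,\mathrm{T}$ denote the collections of countable open $\omega$-, $\gamma$-, $\tau$-covers of $X$, and $\mathcal{B}_\Omega,\mathcal{B}_\Gamma,\mathcal{B}_\mathrm{T}$ the collections of countable Borel $\omega$-, $\gamma$-, $\tau$-covers. For collections $\mathfrak{U},\mathfrak{V}$ of covers: $X$ satisfies $\mathsf{S}_1(\mathfrak{U},\mathfrak{V})$ if for every sequence $(\mathcal{U}_n)$ of members of $\mathfrak{U}$ there are $V_n\in\mathcal{U}_n$ with $\{V_n:n\in\mathbb{N}\}\in\mathfrak{V}$; $X$ satisfies $\mathsf{S}_{fin}(\mathfrak{U},\mathfrak{V})$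 if for every sequence $(\mathcal{U}_n)$ of members of $\mathfrak{U}$ there are finite (possibly empty) $\mathcal{F}_n\subseteq\mathcal{U}_n$ with $\bigcup_n\mathcal{F}_n\in\mathfrak{V}$; $X$ satisfies $\binom{\mathfrak{U}}{\mathfrak{V}}$ if every $\mathcal{U}\in\mathfrak{U}$ has a subcollection $\mathcal{V}\subseteq\mathcal{U}$ with $\mathcal{V}\in\mathfrak{V}$. Properties are identified with the classes of sets satisfying them. *)

theory Defs
  imports "HOL-Analysis.Analysis"
begin

(* Members of a cover are subsets of X itself, since openness and Borelness are taken in the
   subspace X; the whole space X is never allowed as a member. *)
definition cover_of :: "'a set \<Rightarrow> 'a set set \<Rightarrow> bool" where
  "cover_of X \<U> \<longleftrightarrow> \<Union>\<U> = X \<and> X \<notin> \<U>"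

definition omega_cover :: "'a set \<Rightarrow> 'a set set \<Rightarrow> bool" where
  "omega_cover X \<U> \<longleftrightarrow> cover_of X \<U> \<and> (\<forall>F. finite F \<and> F \<subseteq> X \<longrightarrow> (\<exists>U\<in>\<U>. F \<subseteq> U))"

definition gamma_cover :: "'a set \<Rightarrow> 'a set set \<Rightarrow> bool" where
  "gamma_cover X \<U> \<longleftrightarrow> cover_of X \<U> \<and> infinite \<U> \<and> (\<forall>x\<in>X. finite {U\<in>\<U>. x \<notin> U})"

definition large_cover :: "'a set \<Rightarrow> 'a set set \<Rightarrow> bool" where
  "large_cover X \<U> \<longleftrightarrow> cover_of X \<U> \<and> (\<forall>x\<in>X. infinite {U\<in>\<U>. x \<in> U})"

definition tau_cover :: "'a set \<Rightarrow> 'a set set \<Rightarrow> bool" where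
  "tau_cover X \<U> \<longleftrightarrow> large_cover X \<U> \<and>
     (\<forall>x\<in>X. \<forall>y\<in>X. finite {U\<in>\<U>. \<not> (x \<in> U \<longrightarrow> y \<in> U)} \<or>
                   finite {U\<in>\<U>. \<not> (y \<in> U \<longrightarrow> x \<in> U)})"

definition countable_open :: "real set \<Rightarrow> real set set \<Rightarrow> bool" where
  "countable_open X \<U> \<longleftrightarrow> countable \<U> \<and> (\<forall>U\<in>\<U>. openin (top_of_set X) U)"

(* restrict_space borel X carries the Borel sigma-algebra of the subspace X, also when X is not
   itself a Borel set of reals. *)
definition countable_borel :: "real set \<Rightarrow> real set set \<Rightarrow> bool" where
  "countable_borel X \<U> \<longleftrightarrow> countable \<U> \<and> (\<forall>U\<in>\<U>. U \<in> sets (restrict_space borel X))"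

(* A collection of covers depends on the space, so it is a function of X. *)
type_synonym covers = "real set \<Rightarrow> real set set set"

definition O_Omega :: covers where
  "O_Omega X = {\<U>. countable_open X \<U> \<and> omega_cover X \<U>}"

definition O_Gamma :: covers where
  "O_Gamma X = {\<U>. countable_open X \<U> \<and> gamma_cover X \<U>}"

definition O_Tau :: covers where
  "O_Tau X = {\<U>. countable_open X \<U> \<and> tau_cover X \<U>}"

definition B_Omega :: covers where
  "B_Omega X = {\<U>. countable_borel X \<U> \<and> omega_cover X \<U>}"

definition B_Gamma :: covers where
  "B_Gamma X = {\<U>. countable_borel X \<U> \<and> gamma_cover X \<U>}"

definition B_Tau :: covers where
  "B_Tau X = {\<U>. countable_borel X \<U> \<and> tau_cover X \<U>}"

(* Each property is identified with the class of spaces (infinite sets of reals) satisfying it. *)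
definition S_1 :: "covers \<Rightarrow> covers \<Rightarrow> real set set" where
  "S_1 \<AA> \<BB> = {X. infinite X \<and>
     (\<forall>\<U>::nat \<Rightarrow> real set set. (\<forall>n. \<U> n \<in> \<AA> X) \<longrightarrow>
        (\<exists>V. (\<forall>n. V n \<in> \<U> n) \<and> range V \<in> \<BB> X))}"

definition S_fin :: "covers \<Rightarrow> covers \<Rightarrow> real set set" where
  "S_fin \<AA> \<BB> = {X. infinite X \<and>
     (\<forall>\<U>::nat \<Rightarrow> real set set. (\<forall>n. \<U> n \<in> \<AA> X) \<longrightarrow>
        (\<exists>\<F>. (\<forall>n. finite (\<F> n) \<and> \<F> n \<subseteq> \<U> n) \<and> (\<Union>n. \<F> n) \<in> \<BB> X))}"

(* The property written as a binomial symbol, with the first collection on top. *)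
definition subcover_prop :: "covers \<Rightarrow> covers \<Rightarrow> real set set" where
  "subcover_prop \<AA> \<BB> = {X. infinite X \<and> (\<forall>\<U>\<in>\<AA> X. \<exists>\<V>\<subseteq>\<U>. \<V> \<in> \<BB> X)}"

end

theory Submission
  imports Defs
begin

text \<open>
  A \<tau>-cover preorders every finite set of points linearly modulo finite. Almost all of the
  infinitely many members that contain a minimal point contain the whole finite set, so \<tau>-covers
  are \<omega>-covers. The right-hand side therefore yields that every \<omega>-cover has a \<gamma>-subcover, and
  the argument of Gerlits and Nagy applies: refine the given covers to a decreasing sequence,
  delete from the members of the n-th cover the n-th term of a sequence of distinct points, and
  take a \<gamma>-subcover of the union of all these families. Since a \<gamma>-cover has only finitely many
  members that miss a given point, it uses arbitrarily late families.
\<close>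

text \<open>\<open>M X\<close> stands for the admissible subsets of the space: its relatively open
  sets or its Borel sets. With \<open>M\<close> as a parameter, one argument serves both
  equalities.\<close>

definition countable_covers ::
    "(real set \<Rightarrow> real set set) \<Rightarrow> (real set \<Rightarrow> real set set \<Rightarrow> bool) \<Rightarrow> covers" where
  "countable_covers M P X = {\<U>. countable \<U> \<and> \<U> \<subseteq> M X \<and> P X \<U>}"

section \<open>From \<gamma>-covers to \<tau>-covers to \<omega>-covers\<close>

lemma gamma_cover_imp_tau_cover:
  assumes "gamma_cover X \<U>"
  shows "tau_cover X \<U>"
proof -
  have fin: "finite {U \<in> \<U>. x \<notin> U}" if "x \<in> X" for x
    using assms that by (auto simp: gamma_cover_def)
  have "infinite {U \<in> \<U>. x \<in> U}" if "x \<in> X" for x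
  proof
    assume "finite {U \<in> \<U>. x \<in> U}"
    then have "finite ({U \<in> \<U>. x \<in> U} \<union> {U \<in> \<U>. x \<notin> U})"
      using fin[OF that] by blast
    moreover have "{U \<in> \<U>. x \<in> U} \<union> {U \<in> \<U>. x \<notin> U} = \<U>" by blast
    ultimately show False
      using assms by (simp add: gamma_cover_def)
  qed
  moreover have "finite {U \<in> \<U>. \<not> (x \<in> U \<longrightarrow> y \<in> U)}" if "y \<in> X" for x y
    by (rule finite_subset[OF _ fin[OF that]]) auto
  ultimately show ?thesis
    using assms by (simp add: tau_cover_def large_cover_def gamma_cover_def)
qed

lemma tau_cover_minimal_point:
  assumes "tau_cover X \<U>" "finite F" "F \<noteq> {}" "F \<subseteq> X"
  shows "\<exists>x\<in>F. \<forall>y\<in>F. finite {U \<in> \<U>. x \<in> U \<and> y \<notin> U}"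
  using assms(2-4)
proof (induction F rule: finite_ne_induct)
  case (singleton a)
  then show ?case by simp
next
  case (insert a F)
  then obtain x where x: "x \<in> F" "\<And>y. y \<in> F \<Longrightarrow> finite {U \<in> \<U>. x \<in> U \<and> y \<notin> U}"
    by auto
  then have "finite {U \<in> \<U>. x \<in> U \<and> a \<notin> U} \<or> finite {U \<in> \<U>. a \<in> U \<and> x \<notin> U}"
    using assms(1) insert.prems by (auto simp: tau_cover_def)
  then show ?case
  proof
    assume "finite {U \<in> \<U>. x \<in> U \<and> a \<notin> U}"
    then show ?thesis using x by auto
  next
    assume fin: "finite {U \<in> \<U>. a \<in> U \<and> x \<notin> U}"
    \<comment> \<open>The new point \<open>a\<close> replaces \<open>x\<close> as the minimal one,
      by transitivity: a member that contains \<open>a\<close> and misses \<open>y\<close> either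
      misses \<open>x\<close>, or contains \<open>x\<close> and misses \<open>y\<close>.\<close>
    have "finite {U \<in> \<U>. a \<in> U \<and> y \<notin> U}" if "y \<in> F" for y
      by (rule finite_subset[OF _ finite_UnI[OF fin x(2)[OF that]]]) auto
    then show ?thesis by auto
  qed
qed

lemma tau_cover_imp_omega_cover:
  assumes tau: "tau_cover X \<U>" and "X \<noteq> {}"
  shows "omega_cover X \<U>"
proof -
  have cov: "cover_of X \<U>"
    and inf: "\<And>x. x \<in> X \<Longrightarrow> infinite {U \<in> \<U>. x \<in> U}"
    using tau by (auto simp: tau_cover_def large_cover_def)
  have "\<exists>U\<in>\<U>. F \<subseteq> U" if F: "finite F" "F \<subseteq> X" for F
  proof (cases "F = {}")
    \<comment> \<open>The empty set has no minimal point, but any member contains it, and \<U> has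
      one because its union is nonempty.\<close>
    case True
    then show ?thesis using cov \<open>X \<noteq> {}\<close> by (auto simp: cover_of_def)
  next
    case False
    obtain x where x: "x \<in> F" "\<And>y. y \<in> F \<Longrightarrow> finite {U \<in> \<U>. x \<in> U \<and> y \<notin> U}"
      using tau_cover_minimal_point[OF tau F(1) False F(2)] by blast
    have "finite (\<Union>y\<in>F. {U \<in> \<U>. x \<in> U \<and> y \<notin> U})"
      using F(1) x(2) by blast
    then have "\<not> {U \<in> \<U>. x \<in> U} \<subseteq> (\<Union>y\<in>F. {U \<in> \<U>. x \<in> U \<and> y \<notin> U})"
      using inf x(1) F(2) finite_subset by blast
    then show ?thesis by blast
  qed
  then show ?thesis using cov by (simp add: omega_cover_def)
qed

text \<open>The sequence may repeat sets, so infinitely many indices need not give infinitely many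
  members. They do here: a set taken at infinitely many indices would contain every point of
  \<open>X\<close>, hence equal \<open>X\<close>, which \<open>ne\<close> forbids.\<close>

lemma gamma_cover_range:
  assumes "X \<noteq> {}" and sub: "\<And>n. V n \<subseteq> X" and ne: "\<And>n. V n \<noteq> X"
    and fin: "\<And>x. x \<in> X \<Longrightarrow> finite {n::nat. x \<notin> V n}"
  shows "gamma_cover X (range V)"
proof -
  have "finite {U \<in> range V. x \<notin> U}" if "x \<in> X" for x
    by (rule finite_subset[OF _ finite_imageI[OF fin[OF that], of V]]) auto
  moreover have "infinite (range V)"
  proof
    assume "finite (range V)"
    then obtain U where U: "infinite {n. V n = U}"
      using inf_img_fin_domE[of V UNIV] by (auto simp: vimage_def)
    have "x \<in> U" if "x \<in> X" for x
    proof (rule ccontr)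
      assume "x \<notin> U"
      then have "{n. V n = U} \<subseteq> {n. x \<notin> V n}" by auto
      then show False using U fin[OF that] finite_subset by blast
    qed
    moreover obtain n where "V n = U" using U not_finite_existsD by blast
    ultimately show False using sub[of n] ne[of n] by auto
  qed
  moreover have "\<exists>n. x \<in> V n" if "x \<in> X" for x
    using fin[OF that] by (metis (mono_tags, lifting) UNIV_eq_I infinite_UNIV_nat mem_Collect_eq)
  ultimately show ?thesis
    using sub ne by (fastforce simp: gamma_cover_def cover_of_def)
qed

section \<open>Common refinements and selection from them\<close>

primrec common_refinement :: "(nat \<Rightarrow> 'a set set) \<Rightarrow> nat \<Rightarrow> 'a set set" where
  "common_refinement \<U> 0 = \<U> 0"
| "common_refinement \<U> (Suc n) = (\<lambda>(A, B). A \<inter> B) ` (common_refinement \<U> n \<times> \<U> (Suc n))"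

lemma common_refinement_countable:
  "(\<And>n. countable (\<U> n)) \<Longrightarrow> countable (common_refinement \<U> n)"
  by (induction n) auto

lemma common_refinement_closed:
  assumes "\<And>n. \<U> n \<subseteq> M" "\<And>A B. A \<in> M \<Longrightarrow> B \<in> M \<Longrightarrow> A \<inter> B \<in> M"
  shows "common_refinement \<U> n \<subseteq> M"
proof (induction n)
  case (Suc n)
  have "A \<inter> B \<in> M" if "A \<in> common_refinement \<U> n" "B \<in> \<U> (Suc n)" for A B
    using Suc.IH assms(1)[of "Suc n"] that by (intro assms(2)) auto
  then show ?case by auto
qed (use assms(1) in simp)

lemma common_refinement_refines:
  "A \<in> common_refinement \<U> n \<Longrightarrow> i \<le> n \<Longrightarrow> \<exists>B\<in>\<U> i. A \<subseteq> B"
proof (induction n arbitrary: A)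
  case (Suc n)
  then obtain C B where C: "C \<in> common_refinement \<U> n" "B \<in> \<U> (Suc n)" "A = C \<inter> B"
    by auto
  show ?case
  proof (cases "i = Suc n")
    case True
    then show ?thesis using C by blast
  next
    case False
    then obtain D where "D \<in> \<U> i" "C \<subseteq> D" using Suc.IH[OF C(1)] Suc.prems(2) by auto
    then show ?thesis using C(3) by blast
  qed
qed auto

lemma common_refinement_omega:
  assumes "\<And>n. \<exists>U\<in>\<U> n. F \<subseteq> U"
  shows "\<exists>U\<in>common_refinement \<U> n. F \<subseteq> U"
proof (induction n)
  case (Suc n)
  then obtain A B where "A \<in> common_refinement \<U> n" "F \<subseteq> A" "B \<in> \<U> (Suc n)" "F \<subseteq> B"
    using assms by blast
  then show ?case by (auto intro!: bexI[of _ "(A, B)"])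
qed (use assms in simp)

text \<open>The closure properties of \<open>M\<close> keep the auxiliary family \<N> within
  \<open>M\<close>, so that \<open>sel\<close> applies to it. Refinement then lets a set from a late
  family be enlarged to a member of any earlier cover.\<close>

lemma Gerlits_Nagy:
  fixes X :: "'a set" and \<U> :: "nat \<Rightarrow> 'a set set"
  assumes X: "infinite X"
    and M_Int: "\<And>A B. A \<in> M \<Longrightarrow> B \<in> M \<Longrightarrow> A \<inter> B \<in> M"
    and M_del: "\<And>A x. A \<in> M \<Longrightarrow> A - {x} \<in> M"
    and sel: "\<And>\<V>. countable \<V> \<Longrightarrow> \<V> \<subseteq> M \<Longrightarrow> omega_cover X \<V> \<Longrightarrow> \<exists>\<G>\<subseteq>\<V>. gamma_cover X \<G>"
    and \<U>: "\<And>n. countable (\<U> n)" "\<And>n. \<U> n \<subseteq> M" "\<And>n. omega_cover X (\<U> n)"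
  shows "\<exists>V. (\<forall>n. V n \<in> \<U> n) \<and> gamma_cover X (range V)"
proof -
  obtain x :: "nat \<Rightarrow> 'a" where x: "inj x" "range x \<subseteq> X"
    using infinite_countable_subset[OF X] by blast
  define \<W> where "\<W> = common_refinement \<U>"
  \<comment> \<open>Deleting \<open>x n\<close> keeps \<open>X\<close> out of \<N>, and it marks the
    n-th family by a point that all its members miss.\<close>
  define \<N> where "\<N> = (\<Union>n. (\<lambda>U. U - {x n}) ` \<W> n)"
  have sub: "U \<subseteq> X" and ne: "U \<noteq> X" if "U \<in> \<U> n" for U n
    using \<U>(3)[of n] that by (auto simp: omega_cover_def cover_of_def)
  have \<W>_sub: "U \<subseteq> X" if "U \<in> \<W> n" for U n
    using common_refinement_refines[of U \<U> n n] that sub unfolding \<W>_def by blast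
  have \<N>_omega: "\<exists>U\<in>\<N>. F \<subseteq> U" if F: "finite F" "F \<subseteq> X" for F
  proof -
    \<comment> \<open>The deletion is harmless to \<open>F\<close> at such an index, which exists
      because \<open>x\<close> is injective and \<open>F\<close> finite.\<close>
    obtain n where n: "x n \<notin> F"
      using x(1) F(1) by (meson finite_subset image_subsetI range_inj_infinite)
    have "\<exists>U\<in>\<W> n. F \<subseteq> U" unfolding \<W>_def
      using \<U>(3) F by (intro common_refinement_omega) (auto simp: omega_cover_def)
    then obtain U where "U \<in> \<W> n" "F \<subseteq> U" by blast
    then have "U - {x n} \<in> \<N>" "F \<subseteq> U - {x n}"
      using n by (auto simp: \<N>_def)
    then show ?thesis by blast
  qed
  have "\<Union>\<N> = X"
  proof
    show "\<Union>\<N> \<subseteq> X" using \<W>_sub by (fastforce simp: \<N>_def)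
    show "X \<subseteq> \<Union>\<N>"
    proof
      fix y assume "y \<in> X"
      then show "y \<in> \<Union>\<N>" using \<N>_omega[of "{y}"] by auto
    qed
  qed
  moreover have "X \<notin> \<N>" using x(2) by (auto simp: \<N>_def)
  ultimately have "omega_cover X \<N>"
    using \<N>_omega by (simp add: omega_cover_def cover_of_def)
  moreover have "countable \<N>"
    using common_refinement_countable[OF \<U>(1)] by (simp add: \<N>_def \<W>_def)
  moreover have "\<N> \<subseteq> M"
  proof -
    have "\<W> n \<subseteq> M" for n
      unfolding \<W>_def using \<U>(2) M_Int by (rule common_refinement_closed)
    then show ?thesis using M_del by (auto simp: \<N>_def)
  qed
  ultimately obtain \<G> where \<G>: "\<G> \<subseteq> \<N>" "gamma_cover X \<G>"
    using sel by blast
  have "\<forall>g\<in>\<G>. \<exists>n. g \<in> (\<lambda>U. U - {x n}) ` \<W> n"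
    using \<G>(1) unfolding \<N>_def by blast
  \<comment> \<open>A set may arise from several families; \<open>k\<close> fixes one index for
    each.\<close>
  then obtain k where k: "\<And>g. g \<in> \<G> \<Longrightarrow> g \<in> (\<lambda>U. U - {x (k g)}) ` \<W> (k g)"
    by metis
  have fin: "finite {g \<in> \<G>. y \<notin> g}" if "y \<in> X" for y
    using \<G>(2) that by (auto simp: gamma_cover_def)
  have "\<exists>g\<in>\<G>. n \<le> k g" for n
  proof (rule ccontr)
    assume "\<not> (\<exists>g\<in>\<G>. n \<le> k g)"
    \<comment> \<open>Every \<open>g\<close> misses \<open>x (k g)\<close>. If all these indices
      were below \<open>n\<close>, finitely many points would account for the whole of \<G>, which
      would then be finite.\<close>
    then have "\<G> \<subseteq> (\<Union>i<n. {g \<in> \<G>. x i \<notin> g})"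
      using k by fastforce
    moreover have "finite (\<Union>i<n. {g \<in> \<G>. x i \<notin> g})"
      using fin x(2) by auto
    ultimately show False
      using \<G>(2) unfolding gamma_cover_def by (meson finite_subset)
  qed
  then obtain g where g: "\<And>n. g n \<in> \<G>" "\<And>n. n \<le> k (g n)"
    by metis
  have "\<exists>V\<in>\<U> n. g n \<subseteq> V" for n
  proof -
    obtain U where U: "U \<in> \<W> (k (g n))" "g n \<subseteq> U" using k[OF g(1), of n] by blast
    obtain B where "B \<in> \<U> n" "U \<subseteq> B"
      using common_refinement_refines[OF U(1)[unfolded \<W>_def] g(2)] by blast
    then show ?thesis using U(2) by blast
  qed
  then obtain V where V: "\<And>n. V n \<in> \<U> n" "\<And>n. g n \<subseteq> V n"
    by metis
  have "finite {n. y \<notin> V n}" if "y \<in> X" for y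
  proof (rule finite_subset)
    \<comment> \<open>The sequence \<open>g\<close> may repeat values, but a value \<open>h\<close>
      occurs only at indices up to \<open>k h\<close>. So the finitely many \<open>h\<close> that
      miss \<open>y\<close> affect only finitely many \<open>n\<close>.\<close>
    show "{n. y \<notin> V n} \<subseteq> (\<Union>h\<in>{h \<in> \<G>. y \<notin> h}. {..k h})"
    proof
      fix n assume "n \<in> {n. y \<notin> V n}"
      then have "y \<notin> g n" using V(2)[of n] by auto
      then show "n \<in> (\<Union>h\<in>{h \<in> \<G>. y \<notin> h}. {..k h})" using g[of n] by auto
    qed
    show "finite (\<Union>h\<in>{h \<in> \<G>. y \<notin> h}. {..k h})"
      using fin[OF that] by blast
  qed
  then have "gamma_cover X (range V)"
    using X sub[OF V(1)] ne[OF V(1)] by (intro gamma_cover_range) auto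
  then show ?thesis using V(1) by blast
qed

section \<open>The equality for an abstract family of admissible sets\<close>

lemma S_1_omega_gamma_eq:
  assumes M_Int: "\<And>X A B. A \<in> M X \<Longrightarrow> B \<in> M X \<Longrightarrow> A \<inter> B \<in> M X"
    and M_del: "\<And>X A x. A \<in> M X \<Longrightarrow> A - {x} \<in> M X"
  shows "S_1 (countable_covers M omega_cover) (countable_covers M gamma_cover) =
    subcover_prop (countable_covers M tau_cover) (countable_covers M gamma_cover) \<inter>
    S_fin (countable_covers M omega_cover) (countable_covers M tau_cover)"
    (is "S_1 ?\<Omega> ?\<Gamma> = subcover_prop ?T ?\<Gamma> \<inter> S_fin ?\<Omega> ?T")
proof (intro equalityI subsetI IntI)
  fix X assume X: "X \<in> S_1 ?\<Omega> ?\<Gamma>"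
  then have inf: "infinite X" by (simp add: S_1_def)
  have S1: "\<exists>V. (\<forall>n. V n \<in> \<U> n) \<and> range V \<in> ?\<Gamma> X" if "\<And>n. \<U> n \<in> ?\<Omega> X"
    for \<U> :: "nat \<Rightarrow> real set set"
    using X that by (simp add: S_1_def)
  have "\<exists>\<V>\<subseteq>\<U>. \<V> \<in> ?\<Gamma> X" if "\<U> \<in> ?T X" for \<U>
  proof -
    have "\<U> \<in> ?\<Omega> X"
      using that inf tau_cover_imp_omega_cover[of X \<U>] by (auto simp: countable_covers_def)
    \<comment> \<open>Selecting from a constant sequence of covers yields a subfamily of that
      cover.\<close>
    then show ?thesis using S1[of "\<lambda>_. \<U>"] by blast
  qed
  then show "X \<in> subcover_prop ?T ?\<Gamma>" using inf by (simp add: subcover_prop_def)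
  have "\<exists>\<F>. (\<forall>n. finite (\<F> n) \<and> \<F> n \<subseteq> \<U> n) \<and> (\<Union>n. \<F> n) \<in> ?T X"
    if \<U>: "\<And>n. \<U> n \<in> ?\<Omega> X" for \<U> :: "nat \<Rightarrow> real set set"
  proof -
    obtain V where V: "\<And>n. V n \<in> \<U> n" "range V \<in> ?\<Gamma> X" using S1[of \<U>, OF \<U>] by blast
    then have "range V \<in> ?T X"
      using gamma_cover_imp_tau_cover by (auto simp: countable_covers_def)
    moreover have "(\<Union>n. {V n}) = range V" by blast
    ultimately show ?thesis using V(1) by (intro exI[of _ "\<lambda>n. {V n}"]) simp
  qed
  then show "X \<in> S_fin ?\<Omega> ?T" using inf by (simp add: S_fin_def)
next
  fix X assume X: "X \<in> subcover_prop ?T ?\<Gamma> \<inter> S_fin ?\<Omega> ?T"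
  then have inf: "infinite X" by (simp add: S_fin_def)
  have sel: "\<exists>\<G>\<subseteq>\<V>. gamma_cover X \<G>"
    if "countable \<V>" "\<V> \<subseteq> M X" "omega_cover X \<V>" for \<V>
  proof -
    have fin: "\<forall>\<U>. (\<forall>n. \<U> n \<in> ?\<Omega> X) \<longrightarrow>
        (\<exists>\<F>. (\<forall>n. finite (\<F> n) \<and> \<F> n \<subseteq> \<U> n) \<and> (\<Union>n::nat. \<F> n) \<in> ?T X)"
      using X by (simp add: S_fin_def)
    have "\<V> \<in> ?\<Omega> X" using that by (simp add: countable_covers_def)
    then obtain \<F> where \<F>: "\<forall>n::nat. finite (\<F> n) \<and> \<F> n \<subseteq> \<V>" "(\<Union>n. \<F> n) \<in> ?T X"
      \<comment> \<open>With a constant sequence, the union of the finite selections is a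
        \<tau>-cover inside \<V>, to which the subcover property applies.\<close>
      using spec[OF fin, of "\<lambda>_. \<V>"] by blast
    then obtain \<G> where "\<G> \<subseteq> (\<Union>n. \<F> n)" "\<G> \<in> ?\<Gamma> X"
      using X by (auto simp: subcover_prop_def)
    moreover have "(\<Union>n. \<F> n) \<subseteq> \<V>" using \<F>(1) by blast
    ultimately show ?thesis by (auto simp: countable_covers_def)
  qed
  have "\<exists>V. (\<forall>n. V n \<in> \<U> n) \<and> range V \<in> ?\<Gamma> X"
    if \<U>: "\<And>n. \<U> n \<in> ?\<Omega> X" for \<U> :: "nat \<Rightarrow> real set set"
  proof -
    have "\<exists>V. (\<forall>n. V n \<in> \<U> n) \<and> gamma_cover X (range V)"
      using \<U> by (intro Gerlits_Nagy[OF inf M_Int M_del sel]) (auto simp: countable_covers_def)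
    then show ?thesis using \<U> by (fastforce simp: countable_covers_def)
  qed
  then show "X \<in> S_1 ?\<Omega> ?\<Gamma>" using inf by (simp add: S_1_def)
qed

theorem theorem2p6:
  shows "S_1 O_Omega O_Gamma = subcover_prop O_Tau O_Gamma \<inter> S_fin O_Omega O_Tau
       \<and> S_1 B_Omega B_Gamma = subcover_prop B_Tau B_Gamma \<inter> S_fin B_Omega B_Tau"
proof
  define M where "M X = {U. openin (top_of_set X) U}" for X :: "real set"
  have "openin (top_of_set X) (U - {x})" if "openin (top_of_set X) U" for X U and x :: real
  proof -
    \<comment> \<open>Points are closed in the reals, so a deletion is an intersection with a
      relatively open set.\<close>
    have "U - {x} = U \<inter> (X \<inter> - {x})" using openin_imp_subset[OF that] by blast
    moreover have "openin (top_of_set X) (X \<inter> - {x})" by (intro openin_open_Int) auto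
    ultimately show ?thesis using that by (simp only: openin_Int)
  qed
  moreover have "O_Omega = countable_covers M omega_cover"
    "O_Gamma = countable_covers M gamma_cover" "O_Tau = countable_covers M tau_cover"
    by (auto simp: fun_eq_iff countable_covers_def M_def countable_open_def
        O_Omega_def O_Gamma_def O_Tau_def)
  ultimately show "S_1 O_Omega O_Gamma = subcover_prop O_Tau O_Gamma \<inter> S_fin O_Omega O_Tau"
    using S_1_omega_gamma_eq[of M] by (simp add: M_def openin_Int)
next
  define M where "M X = sets (restrict_space borel X)" for X :: "real set"
  have "U - {x} \<in> sets (restrict_space borel X)"
    if U: "U \<in> sets (restrict_space borel X)" for X U and x :: real
  proof -
    \<comment> \<open>Since \<open>X\<close> need not be Borel, the point is deleted from a Borel
      set of reals whose trace on \<open>X\<close> is \<open>U\<close>.\<close>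
    obtain B where B: "B \<in> sets borel" "U = X \<inter> B"
      using U unfolding sets_restrict_space by blast
    have "B - {x} \<in> sets borel" using B(1) by (intro sets.Diff) auto
    moreover have "U - {x} = X \<inter> (B - {x})" unfolding B(2) by (rule Int_Diff)
    ultimately show ?thesis unfolding sets_restrict_space by (rule rev_image_eqI)
  qed
  moreover have "B_Omega = countable_covers M omega_cover"
    "B_Gamma = countable_covers M gamma_cover" "B_Tau = countable_covers M tau_cover"
    by (auto simp: fun_eq_iff countable_covers_def M_def countable_borel_def
        B_Omega_def B_Gamma_def B_Tau_def)
  ultimately show "S_1 B_Omega B_Gamma = subcover_prop B_Tau B_Gamma \<inter> S_fin B_Omega B_Tau"
    using S_1_omega_gamma_eq[of M] by (simp add: M_def sets.Int)
qed

end
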